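(* Let $\Gamma\neq\mathbb{N}$ be a numerical semigroup. Then for every gap $g\in\mathbb{N}\setminus\Gamma$ one has $W(g)\le W_\Gamma(4)=4\delta(\Gamma)-c(\Gamma)$; that is, $\max_{g\in\mathbb{N}\setminus\Gamma}W(g)\le W_\Gamma(4)$.
   Context: A numerical semigroup is an additive submonoid $\Gamma\subseteq\mathbb{N}$ with finite complement; its elements not in $\Gamma$ are gaps. A $\Gamma$-semimodule is a nonempty subset $\Delta\subseteq\mathbb{Z}$, bounded below, with $\Delta+\Gamma\subseteq\Delta$. For $\Delta\subseteq\mathbb{N}$ with $\mathbb{N}\setminus\Delta$ finite, its conductor $c(\Delta)$ is one more than the largest element of $\mathbb{N}\setminus\Delta$ and $\delta(\Delta)=|\{x\in\Delta: x<c(\Delta)\}|$; in particular this defines $c(\Gamma),\delta(\Gamma)$. $W_\Gamma(k)=k\delta(\Gamma)-c(\Gamma)$. For a gap $g$ of $\Gamma$, let $\Delta_g=\Gamma\cup(g+\Gamma)$ be the $\Gamma$-semimodule minimally generated by $\{0,g\}$, and define the Wilf number of the gap as $W(g)=2\delta(\Delta_g)-c(\Delta_g)$. *)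

theory Defs
  imports Main
begin

definition numerical_semigroup :: "nat set \<Rightarrow> bool" where
  "numerical_semigroup G \<longleftrightarrow>
     0 \<in> G \<and> (\<forall>x\<in>G. \<forall>y\<in>G. x + y \<in> G) \<and> finite (UNIV - G)"

definition gaps :: "nat set \<Rightarrow> nat set" where
  "gaps G = UNIV - G"

(* Meant for cofinite D only.  If D is all of the naturals, the largest missing integer is -1,
   so the conductor is 0; this case does occur, e.g. for D = G \<union> (1 + G) with G = UNIV - {1}. *)
definition conductor :: "nat set \<Rightarrow> nat" where
  "conductor D = (if D = UNIV then 0 else Max (UNIV - D) + 1)"

definition delta :: "nat set \<Rightarrow> nat" where
  "delta D = card {x \<in> D. x < conductor D}"

definition wilf :: "nat set \<Rightarrow> nat \<Rightarrow> int" where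
  "wilf G k = int k * int (delta G) - int (conductor G)"

definition gap_semimodule :: "nat set \<Rightarrow> nat \<Rightarrow> nat set" where
  "gap_semimodule G g = G \<union> (\<lambda>x. g + x) ` G"

definition gap_wilf :: "nat set \<Rightarrow> nat \<Rightarrow> int" where
  "gap_wilf G g =
     2 * int (delta (gap_semimodule G g)) - int (conductor (gap_semimodule G g))"

end

(* Write D for the semimodule generated by 0 and g, c for the conductor of G and c' for that of D,
   so that c' <= c.  Every element of D below c' and every integer in [c', c) lies in G or in g + G.
   Hence 2 delta(D) + (c - c') counts each element of G below c at most twice as an element of G
   and at most twice through its translate by g, which gives 2 delta(D) - c' <= 4 delta(G) - c. *)
theory Submission
  imports Defs
begin

lemma conductor_le_imp_mem:
  assumes "finite (UNIV - D)" and "conductor D \<le> x"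
  shows "x \<in> D"
proof (rule ccontr)
  assume "x \<notin> D"
  then have "D \<noteq> UNIV" and "x \<le> Max (UNIV - D)"
    using assms(1) by auto
  then show False
    using assms(2) by (simp add: conductor_def)
qed

lemma conductor_antimono:
  assumes "finite (UNIV - G)" and "G \<subseteq> D"
  shows "conductor D \<le> conductor G"
proof (cases "D = UNIV")
  case False
  \<comment> \<open>\<open>Max_mono\<close> requires \<open>UNIV - D\<close> to be nonempty, hence
    the case split.\<close>
  then have "Max (UNIV - D) \<le> Max (UNIV - G)"
    using assms by (intro Max_mono) auto
  then show ?thesis
    using False assms(2) by (auto simp: conductor_def)
qed (simp add: conductor_def)

lemma gap_wilf_le:
  assumes fin: "finite (UNIV - G)"
  shows "gap_wilf G g \<le> wilf G 4"
proof -
  define D where "D = gap_semimodule G g"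
  define c where "c = conductor G"
  define c' where "c' = conductor D"
  have GD: "G \<subseteq> D"
    by (auto simp: D_def gap_semimodule_def)
  have finD: "finite (UNIV - D)"
    using GD by (intro finite_subset[OF _ fin]) auto
  have le: "c' \<le> c"
    unfolding c_def c'_def using fin GD by (rule conductor_antimono)
  \<comment> \<open>\<open>A\<close> and \<open>A'\<close> cut \<open>G\<close> at c' by the element
    itself, \<open>B\<close> and \<open>B'\<close> by its translate by \<open>g\<close>.\<close>
  define A where "A = {x \<in> G. x < c'}"
  define A' where "A' = {x \<in> G. c' \<le> x \<and> x < c}"
  define B where "B = {x \<in> G. g + x < c'}"
  define B' where "B' = {x \<in> G. c' \<le> g + x \<and> g + x < c}"
  have sub: "A \<subseteq> {..<c}" "A' \<subseteq> {..<c}" "B \<subseteq> {..<c}" "B' \<subseteq> {..<c}"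
    using le by (auto simp: A_def A'_def B_def B'_def)
  have finite: "finite A" "finite A'" "finite B" "finite B'"
    using sub[THEN finite_subset] by simp_all
  \<comment> \<open>The predicate is left free because the bound serves both below c' and on [c',
    c).\<close>
  have cover: "card {x \<in> D. P x} \<le> card {x \<in> G. P x} + card {x \<in> G. P (g + x)}"
    if "finite {x \<in> G. P (g + x)}" for P
  proof -
    have "{x \<in> D. P x} = {x \<in> G. P x} \<union> (\<lambda>x. g + x) ` {x \<in> G. P (g + x)}"
      by (auto simp: D_def gap_semimodule_def)
    then have "card {x \<in> D. P x}
        \<le> card {x \<in> G. P x} + card ((\<lambda>x. g + x) ` {x \<in> G. P (g + x)})"
      by (simp add: card_Un_le)
    also have "\<dots> \<le> card {x \<in> G. P x} + card {x \<in> G. P (g + x)}"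
      using that by (intro add_left_mono card_image_le)
    finally show ?thesis .
  qed
  have low: "delta D \<le> card A + card B"
    using cover[of "\<lambda>x. x < c'"] finite by (simp add: delta_def c'_def A_def B_def)
  \<comment> \<open>Nothing is missing from \<open>D\<close> from c' on, so the count on this range
    is exactly c - c'.\<close>
  have "{x \<in> D. c' \<le> x \<and> x < c} = {c'..<c}"
    using conductor_le_imp_mem[OF finD] by (auto simp: c'_def)
  then have high: "c - c' \<le> card A' + card B'"
    using cover[of "\<lambda>x. c' \<le> x \<and> x < c"] finite by (simp add: A'_def B'_def)
  have "card A + card A' = card (A \<union> A')"
    using finite by (intro card_Un_disjoint[symmetric]) (auto simp: A_def A'_def)
  also have "A \<union> A' = {x \<in> G. x < c}"
    using le by (auto simp: A_def A'_def)
  finally have AA: "card A + card A' = delta G"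
    by (simp add: delta_def c_def)
  have "card B + card B' = card (B \<union> B')"
    using finite by (intro card_Un_disjoint[symmetric]) (auto simp: B_def B'_def)
  \<comment> \<open>Only an inequality: elements x < c of \<open>G\<close> with g + x \<ge> c are
    lost.\<close>
  also have "\<dots> \<le> card {x \<in> G. x < c}"
    using le by (intro card_mono) (auto simp: B_def B'_def)
  finally have BB: "card B + card B' \<le> delta G"
    by (simp add: delta_def c_def)
  \<comment> \<open>Twice \<open>low\<close> plus \<open>high\<close>: \<open>A\<close> and
    \<open>B\<close> enter with weight 2, \<open>A'\<close> and \<open>B'\<close> with weight 1,
    which is raised to 2. \<open>le\<close> makes the truncated c - c' a true difference.\<close>
  have "2 * delta D + c \<le> 4 * delta G + c'"
    using low high AA BB le by linarith
  then show ?thesis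
    unfolding gap_wilf_def wilf_def D_def[symmetric] c_def[symmetric] c'_def[symmetric] by simp
qed

theorem theorem4p2:
  fixes G :: "nat set"
  assumes "numerical_semigroup G" and "G \<noteq> UNIV"
  shows "(\<forall>g \<in> gaps G. gap_wilf G g \<le> wilf G 4) \<and>
         Max (gap_wilf G ` gaps G) \<le> wilf G 4"
proof -
  \<comment> \<open>Finiteness and nonemptiness of the gap set reduce the bound on
    \<open>Max\<close> to the bound for each gap.\<close>
  have fin: "finite (gaps G)"
    using assms(1) by (simp add: numerical_semigroup_def gaps_def)
  moreover have "gaps G \<noteq> {}"
    using assms(2) by (auto simp: gaps_def)
  ultimately show ?thesis
    using gap_wilf_le[of G] by (simp add: gaps_def)
qed

end
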